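(* Let $k$ be a positive integer and let $P(z)$ be the polynomial \[ P(z)=\frac{(z+1)(z+2)\cdots(z+k)-k!}{z}\in\mathbb{C}[z]. \] If $z$ is a complex number such that $|z+(k+1)|\ge k+1$, then $|P(z)|\ge (k-1)!$.
   Context: The numerator $(z+1)\cdots(z+k)-k!$ is divisible by $z$, so $P$ is a polynomial, evaluated as a polynomial also at $z=0$. *)

theory Defs
  imports "HOL-Computational_Algebra.Polynomial" Complex_Main
begin

(* The division is exact (see P_poly_exact), so this is the quotient in C[z], and
   poly (P_poly k) 0 is the value at 0 of that polynomial. *)
definition P_poly :: "nat \<Rightarrow> complex poly" where
  "P_poly k = ((\<Prod>i=1..k. [:of_nat i, 1:]) - [:fact k:]) div [:0, 1:]"

lemma P_poly_exact:
  "[:0, 1:] * P_poly k = (\<Prod>i=1..k. [:of_nat i, 1:]) - [:fact k:]"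
proof -
  have "poly ((\<Prod>i=1..k. [:of_nat i, 1:]) - [:fact k:] :: complex poly) 0 = 0"
    by (simp add: poly_prod fact_prod)
  then have "[:0, 1:] dvd ((\<Prod>i=1..k. [:of_nat i, 1:]) - [:fact k:] :: complex poly)"
    unfolding poly_eq_0_iff_dvd minus_zero .
  then show ?thesis
    unfolding P_poly_def by (rule dvd_mult_div_cancel)
qed

end

theory Submission
  imports Defs
begin

text \<open>
  Put \<open>r = \<bar>z\<bar>\<close> and \<open>Q\<^sub>j(z) = (1 + z) (1 + z/2) \<dots> (1 + z/j)\<close>, so that
  \<open>P(z) / k! = (Q\<^sub>k(z) - 1) / z\<close>. What has to be shown is \<open>\<bar>P(z)\<bar> / k! \<ge> 1/k\<close>.
  For \<open>k = 1\<close> this is an equality. For \<open>k \<ge> 2\<close> there are two regimes, which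
  meet exactly at \<open>r = 2 / (k - 1)\<close>.

  For large \<open>r\<close>, the triangle inequality reduces the claim to \<open>\<bar>Q\<^sub>k(z)\<bar> \<ge> 1 + r/k\<close>. The
  hypothesis says \<open>r\<^sup>2 + 2 (k+1) Re z \<ge> 0\<close>, which bounds \<open>Re z\<close> from below and gives
  \<open>\<bar>1 + z/j\<bar>\<^sup>2 \<ge> 1 + r\<^sup>2 (1 - j/(k+1)) / j\<^sup>2\<close> (\<open>norm_factor_lower\<close>). So every factor of
  \<open>Q\<^sub>k\<close> has modulus at least 1, and the first two alone make \<open>\<bar>Q\<^sub>k\<bar>\<^sup>2\<close> grow fast enough
  (\<open>norm_prod_factors_lower\<close>).

  For small \<open>r\<close>, where that estimate is only quadratic in \<open>r\<close>, cancellation between \<open>Q\<^sub>k\<close> and 1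
  is avoided by dividing out \<open>z\<close>: telescoping gives \<open>P(z) / k! = (\<Sum>j<k. Q\<^sub>j(z) / (j+1))\<close>
  (\<open>poly_P_poly_sum\<close>), valid at \<open>z = 0\<close> as well. Here \<open>\<bar>Q\<^sub>j(z) - 1\<bar> \<le> r j\<close>
  (\<open>norm_prod_factors_minus_1\<close>), so the sum differs from the harmonic number \<open>H\<^sub>k\<close> by at most
  \<open>r (k - H\<^sub>k)\<close>, and \<open>H\<^sub>k \<ge> 2 - 1/k\<close> finishes the proof.
\<close>

definition prod_factors :: "nat \<Rightarrow> complex \<Rightarrow> complex" where
  "prod_factors k z = (\<Prod>i=1..k. 1 + z / of_nat i)"

lemma prod_factors_0 [simp]: "prod_factors 0 z = 1"
  by (simp add: prod_factors_def)

lemma prod_factors_Suc: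
  "prod_factors (Suc k) z = prod_factors k z * (1 + z / of_nat (Suc k))"
  by (simp add: prod_factors_def)

lemma fact_mult_prod_factors:
  "fact k * prod_factors k z = (\<Prod>i=1..k. of_nat i + z)"
proof (induction k)
  case (Suc k)
  have "fact (Suc k) * prod_factors (Suc k) z
      = (fact k * prod_factors k z) * (of_nat (Suc k) * (1 + z / of_nat (Suc k)))"
    by (simp only: prod_factors_Suc fact_Suc mult_ac)
  also have "of_nat (Suc k) * (1 + z / of_nat (Suc k)) = of_nat (Suc k) + z"
    by (simp add: field_simps del: of_nat_Suc)
  finally show ?case by (simp add: Suc.IH)
qed simp

lemma poly_P_poly_mult:
  "z * poly (P_poly k) z = fact k * (prod_factors k z - 1)"
proof -
  have "z * poly (P_poly k) z = poly ([:0, 1:] * P_poly k) z"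
    by simp
  also have "\<dots> = (\<Prod>i=1..k. of_nat i + z) - fact k"
    unfolding P_poly_exact by (simp add: poly_prod)
  finally show ?thesis
    by (simp add: fact_mult_prod_factors right_diff_distrib)
qed

text \<open>
  The recurrence is proved for polynomials, where the factor \<open>z\<close> can be cancelled, so that it
  also holds for the values at \<open>0\<close>.
\<close>

lemma P_poly_Suc:
  "P_poly (Suc k) = P_poly k * [:of_nat (Suc k), 1:] + [:fact k:]"
proof -
  let ?x = "[:0, 1:] :: complex poly" and ?l = "[:of_nat (Suc k), 1:] :: complex poly"
  have "?x * P_poly (Suc k) = (\<Prod>i=1..k. [:of_nat i, 1:]) * ?l - [:fact (Suc k):]"
    unfolding P_poly_exact by simp
  also have "(\<Prod>i=1..k. [:of_nat i, 1:]) = ?x * P_poly k + [:fact k:]"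
    by (simp only: P_poly_exact diff_add_cancel)
  also have "(?x * P_poly k + [:fact k:]) * ?l - [:fact (Suc k):]
      = ?x * (P_poly k * ?l + [:fact k:])"
    by (simp add: algebra_simps)
  finally show ?thesis
    by (subst (asm) mult_cancel_left) simp
qed

lemma poly_P_poly_sum:
  "poly (P_poly k) z = fact k * (\<Sum>j<k. prod_factors j z / of_nat (Suc j))"
proof (induction k)
  case 0
  show ?case
    using P_poly_exact[of 0] by (simp add: one_pCons)
next
  case (Suc k)
  have "poly (P_poly (Suc k)) z
      = of_nat (Suc k) * poly (P_poly k) z + (z * poly (P_poly k) z + fact k)"
    by (simp add: P_poly_Suc algebra_simps)
  also have "z * poly (P_poly k) z + fact k = fact k * prod_factors k z"
    by (simp add: poly_P_poly_mult algebra_simps)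
  also have "\<dots> = fact (Suc k) * (prod_factors k z / of_nat (Suc k))"
    by (simp del: of_nat_Suc)
  finally show ?case
    by (simp add: Suc.IH algebra_simps)
qed

text \<open>
  Expanding the product shows \<open>\<bar>Q\<^sub>j(z) - 1\<bar> \<le> Q\<^sub>j(r) - 1\<close> with \<open>r = \<bar>z\<bar>\<close>, where the
  coefficients of \<open>Q\<^sub>j\<close> are nonnegative. The linear bound comes from the chord over \<open>[0, 1]\<close> of the convex function
  \<open>r \<mapsto> (1 + r) (1 + r/2) \<dots> (1 + r/j)\<close>, whose value at \<open>1\<close> is \<open>j + 1\<close>. For
  \<open>j \<le> 1\<close> this function is itself linear, hence no restriction on \<open>r\<close>.
\<close>

lemma norm_prod_factors_minus_1:
  assumes "cmod z \<le> 1 \<or> j \<le> 1"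
  shows "cmod (prod_factors j z - 1) \<le> cmod z * real j"
  using assms
proof (induction j)
  case (Suc j)
  let ?r = "cmod z" and ?n = "real (Suc j)"
  have IH: "cmod (prod_factors j z - 1) \<le> ?r * real j"
    using Suc by auto
  have "prod_factors (Suc j) z - 1
      = (prod_factors j z - 1) * (1 + z / of_nat (Suc j)) + z / of_nat (Suc j)"
    by (simp add: prod_factors_Suc algebra_simps diff_divide_distrib)
  also have "cmod \<dots> \<le> cmod (prod_factors j z - 1) * cmod (1 + z / of_nat (Suc j))
      + cmod (z / of_nat (Suc j))"
    by (metis norm_mult norm_triangle_ineq)
  also have "cmod (z / of_nat (Suc j)) = ?r / ?n"
    by (simp only: norm_divide norm_of_nat)
  also have "cmod (prod_factors j z - 1) * cmod (1 + z / of_nat (Suc j))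
      \<le> (?r * real j) * (1 + ?r / ?n)"
  proof (rule mult_mono[OF IH])
    show "cmod (1 + z / of_nat (Suc j)) \<le> 1 + ?r / ?n"
      by (metis norm_triangle_ineq norm_one norm_divide norm_of_nat)
  qed auto
  also have "(?r * real j) * (1 + ?r / ?n) + ?r / ?n \<le> ?r * ?n"
  proof -
    have "?r * real j * ?r \<le> ?r * real j"
      using Suc.prems by (cases "j = 0") (auto intro!: mult_left_le)
    then have "(?r * real j * ?r + ?r) / ?n \<le> (?r * real j + ?r) / ?n"
      by (intro divide_right_mono) auto
    also have "\<dots> = ?r"
      by (simp add: field_simps)
    finally show ?thesis
      by (simp add: algebra_simps add_divide_distrib)
  qed
  finally show ?case by simp
qed simp

lemma harmonic_lower:
  assumes "k > 0"
  shows "2 - 1 / real k \<le> (\<Sum>j<k. 1 / real (Suc j))"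
  using assms
proof (induction k rule: nat_induct_non_zero)
  case (Suc k)
  have "1 / real k \<le> 2 / real (Suc k)"
    using Suc.hyps by (simp add: field_simps)
  then show ?case
    using Suc.IH by simp
qed simp

lemma norm_P_poly_small:
  assumes k: "k \<ge> 2" and r: "cmod z * (real k - 1) \<le> 2"
  shows "fact k / real k \<le> cmod (poly (P_poly k) z)"
proof -
  let ?r = "cmod z" and ?H = "\<Sum>j<k. 1 / real (Suc j)"
  let ?R = "\<Sum>j<k. prod_factors j z / of_nat (Suc j)"
  have range: "?r \<le> 1 \<or> j \<le> 1" if "j < k" for j
  proof (cases "k = 2")
    case True
    with that show ?thesis by simp
  next
    case False
    with k have "?r * 2 \<le> ?r * (real k - 1)"
      by (intro mult_left_mono) auto
    with r show ?thesis by linarith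
  qed
  have "?R - of_real ?H = (\<Sum>j<k. (prod_factors j z - 1) / of_nat (Suc j))"
    by (simp add: sum_subtractf diff_divide_distrib)
  also have "cmod \<dots> \<le> (\<Sum>j<k. ?r * real j / real (Suc j))"
  proof (rule sum_norm_le)
    fix j assume "j \<in> {..<k}"
    then have "cmod (prod_factors j z - 1) \<le> ?r * real j"
      using range by (intro norm_prod_factors_minus_1) simp
    then show "cmod ((prod_factors j z - 1) / of_nat (Suc j)) \<le> ?r * real j / real (Suc j)"
      unfolding norm_divide norm_of_nat by (intro divide_right_mono) auto
  qed
  also have "\<dots> = (\<Sum>j<k. ?r * (1 - 1 / real (Suc j)))"
    by (intro sum.cong) (auto simp: field_simps)
  also have "\<dots> = ?r * (real k - ?H)"
    by (simp only: sum_distrib_left[symmetric] sum_subtractf) simp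
  finally have dist: "cmod (?R - of_real ?H) \<le> ?r * (real k - ?H)" .
  have "?H \<le> cmod (of_real ?H)"
    unfolding norm_of_real by (rule abs_ge_self)
  also have "\<dots> \<le> cmod ?R + cmod (?R - of_real ?H)"
    by (subst norm_minus_commute) (rule norm_triangle_sub)
  finally have lower: "(1 + ?r) * ?H - ?r * real k \<le> cmod ?R"
    using dist by (simp add: algebra_simps)
  have "(1 + ?r) * (2 - 1 / real k) \<le> (1 + ?r) * ?H"
    using k by (intro mult_left_mono harmonic_lower) auto
  \<comment> \<open>At the boundary value \<open>r = 2 / (k - 1)\<close> the following estimate is an equality.\<close>
  moreover have "1 / real k \<le> (1 + ?r) * (2 - 1 / real k) - ?r * real k"
  proof -
    have "(?r * (real k - 1)) * (real k - 1) \<le> 2 * (real k - 1)"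
      using r k by (intro mult_right_mono) auto
    then show ?thesis
      using k by (simp add: field_simps)
  qed
  ultimately have "1 / real k \<le> cmod ?R"
    using lower by linarith
  then have "fact k * (1 / real k) \<le> fact k * cmod ?R"
    by (intro mult_left_mono) auto
  then show ?thesis
    by (simp add: poly_P_poly_sum norm_mult)
qed

text \<open>
  Squaring the hypothesis gives \<open>2 Re z \<ge> - \<bar>z\<bar>\<^sup>2 / c\<close>, and \<open>Re z\<close> occurs in
  \<open>\<bar>1 + z/j\<bar>\<^sup>2 = 1 + 2 Re z / j + \<bar>z\<bar>\<^sup>2 / j\<^sup>2\<close>. The resulting bound is at least 1
  as long as \<open>j \<le> c\<close>, in particular for all \<open>j \<le> k\<close> when \<open>c = k + 1\<close>.
\<close>

lemma norm_factor_lower: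
  assumes z: "cmod (z + of_real c) \<ge> c" and c: "c > 0" and j: "j > 0"
  shows "1 + (cmod z)\<^sup>2 * (1 - real j / c) / (real j)\<^sup>2 \<le> (cmod (1 + z / of_nat j))\<^sup>2"
proof -
  have "c\<^sup>2 \<le> (cmod (z + of_real c))\<^sup>2"
    using z c by (intro power_mono) auto
  then have "- (cmod z)\<^sup>2 / c \<le> 2 * Re z"
    using c unfolding cmod_power2 by (simp add: power2_eq_square field_simps)
  then have "(- (cmod z)\<^sup>2 / c) / real j \<le> (2 * Re z) / real j"
    by (intro divide_right_mono) auto
  moreover have "(cmod (1 + z / of_nat j))\<^sup>2 = 1 + 2 * Re z / real j + (cmod z)\<^sup>2 / (real j)\<^sup>2"
    using j unfolding cmod_power2 by (simp add: power2_eq_square field_simps)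
  moreover have "(cmod z)\<^sup>2 * (1 - real j / c) / (real j)\<^sup>2
      = (cmod z)\<^sup>2 / (real j)\<^sup>2 + (- (cmod z)\<^sup>2 / c) / real j"
    using j c by (simp add: power2_eq_square field_simps)
  ultimately show ?thesis by linarith
qed

lemma norm_prod_factors_lower:
  assumes k: "k \<ge> 2" and z: "cmod (z + of_nat (k + 1)) \<ge> real (k + 1)"
    and r: "cmod z * (real k - 1) \<ge> 2"
  shows "1 + cmod z / real k \<le> cmod (prod_factors k z)"
proof -
  let ?r = "cmod z" and ?c = "real (k + 1)"
  let ?f = "\<lambda>i. (cmod (1 + z / of_nat i))\<^sup>2"
  have factor: "1 + ?r\<^sup>2 * (1 - real j / ?c) / (real j)\<^sup>2 \<le> ?f j" if "j > 0" for j
    using z that by (intro norm_factor_lower) auto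
  have ge1: "1 \<le> ?f j" if "j \<in> {3..k}" for j
  proof -
    have "0 \<le> ?r\<^sup>2 * (1 - real j / ?c) / (real j)\<^sup>2"
      using that by (intro divide_nonneg_nonneg mult_nonneg_nonneg) auto
    moreover have "j > 0" using that by simp
    ultimately show ?thesis using factor[of j] by linarith
  qed
  define a where "a = ?r\<^sup>2 * (1 - 1 / ?c)"
  define b where "b = ?r\<^sup>2 * (1 - 2 / ?c) / 4"
  have a: "0 \<le> a" "1 + a \<le> ?f 1" and b: "0 \<le> b" "1 + b \<le> ?f 2"
    using factor[of 1] factor[of 2] k by (auto simp: a_def b_def)
  have "(1 + ?r / real k)\<^sup>2 \<le> 1 + a + b"
  proof -
    have K: "real k \<ge> 2" and r0: "?r \<ge> 0" using k by auto
    \<comment> \<open>After the factor \<open>r\<close> is removed, the claim is linear in \<open>r\<close>; at \<open>r = 2 / (k - 1)\<close> it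
      becomes, up to a positive factor, \<open>k\<^sup>3 - k\<^sup>2 - 4 = (k - 2) (k\<^sup>2 + k + 2) \<ge> 0\<close>.\<close>
    define s where "s = 5 / 4 - 3 / (2 * ?c) - 1 / (real k)\<^sup>2"
    have "s * real k - (real k - 1) = (real k - 2) * ((real k)\<^sup>2 + real k + 2) / (4 * real k * ?c)"
    proof -
      have "real k \<noteq> 0" "?c \<noteq> 0"
        using K by auto
      then show ?thesis
        unfolding s_def by (simp add: divide_simps power2_eq_square del: of_nat_Suc)
          (simp add: algebra_simps)
    qed
    also have "\<dots> \<ge> 0"
      using K by (intro divide_nonneg_nonneg mult_nonneg_nonneg) auto
    finally have "?r * (real k - 1) \<le> ?r * (s * real k)"
      by (intro mult_left_mono) auto
    with r have "2 / real k \<le> ?r * s"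
      using K by (simp add: field_simps)
    then have "?r * (2 / real k) \<le> ?r * (?r * s)"
      using r0 by (intro mult_left_mono)
    moreover have "a + b = ?r * (?r * s) + (?r / real k)\<^sup>2"
    proof -
      define u where "u = 1 / ?c"
      have u: "1 / ?c = u" "2 / ?c = 2 * u" "3 / (2 * ?c) = 3 / 2 * u"
        unfolding u_def by simp_all
      show ?thesis
        unfolding a_def b_def s_def u by (simp add: algebra_simps power2_eq_square diff_divide_distrib)
    qed
    ultimately show ?thesis
      by (simp add: power2_sum mult.commute)
  qed
  also have "\<dots> \<le> (1 + a) * (1 + b)"
    using a(1) b(1) by (simp add: algebra_simps)
  also have "\<dots> \<le> ?f 1 * ?f 2"
    using a b by (intro mult_mono) auto
  also have "\<dots> = (?f 1 * ?f 2) * 1"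
    by (simp only: mult_1_right)
  also have "\<dots> \<le> (?f 1 * ?f 2) * (\<Prod>i=3..k. ?f i)"
    using ge1 by (intro mult_left_mono prod_ge_1) auto
  also have "\<dots> = (\<Prod>i=1..k. ?f i)"
  proof -
    have "{1..k} = {1, 2} \<union> {3..k}"
      using k by auto
    moreover have "prod ?f ({1, 2} \<union> {3..k}) = prod ?f {1, 2} * prod ?f {3..k}"
      by (rule prod.union_disjoint) auto
    ultimately have "(\<Prod>i=1..k. ?f i) = prod ?f {1, 2} * prod ?f {3..k}"
      by (simp only:)
    then show ?thesis by simp
  qed
  also have "\<dots> = (cmod (prod_factors k z))\<^sup>2"
    by (simp only: prod_factors_def prod_norm[symmetric] prod_power_distrib)
  finally show ?thesis
    by (rule power2_le_imp_le) simp
qed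

lemma norm_P_poly_large:
  assumes k: "k \<ge> 2" and z: "cmod (z + of_nat (k + 1)) \<ge> real (k + 1)"
    and r: "cmod z * (real k - 1) \<ge> 2"
  shows "fact k / real k \<le> cmod (poly (P_poly k) z)"
proof -
  have "cmod z > 0"
    using r by (cases "z = 0") auto
  have "cmod z / real k \<le> cmod (prod_factors k z) - cmod 1"
    using norm_prod_factors_lower[OF assms] by simp
  also have "\<dots> \<le> cmod (prod_factors k z - 1)"
    by (rule norm_triangle_ineq2)
  finally have "fact k * (cmod z / real k) \<le> fact k * cmod (prod_factors k z - 1)"
    by (intro mult_left_mono) auto
  also have "\<dots> = cmod z * cmod (poly (P_poly k) z)"
    by (metis poly_P_poly_mult norm_mult norm_fact)
  finally have "cmod z * (fact k / real k) \<le> cmod z * cmod (poly (P_poly k) z)"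
    by (simp add: field_simps)
  with \<open>cmod z > 0\<close> show ?thesis
    by (simp only: mult_le_cancel_left_pos)
qed

theorem lemmaA2:
  fixes k :: nat and z :: complex
  assumes "k > 0"
    and "cmod (z + of_nat (k + 1)) \<ge> real (k + 1)"
  shows "cmod (poly (P_poly k) z) \<ge> fact (k - 1)"
proof (cases "k = 1")
  case True
  then show ?thesis
    by (simp add: poly_P_poly_sum)
next
  case False
  with assms(1) have k: "k \<ge> 2" by simp
  have "fact (k - 1) = fact k / real k"
    using assms(1) by (simp add: fact_reduce)
  also have "\<dots> \<le> cmod (poly (P_poly k) z)"
    using norm_P_poly_small[OF k] norm_P_poly_large[OF k assms(2)] by (meson linear)
  finally show ?thesis .
qed

end
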